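(* Let $\hat{\mathbf x}_1,\hat{\mathbf x}_2,\hat{\mathbf x}_3,\hat{\mathbf x}_4$ be four finite points of $\mathrm P\mathbb R^2$ and $\mathbf l$ a line of $\mathrm P\mathbb R^2$ such that the four points and the line are in general position. Then the problem of determining a non-degenerate conic $\mathbf C$ such that $\hat{\mathbf x}_i^T\mathbf C\hat{\mathbf x}_i=0$ for $i=1,2,3,4$ and $\mathbf l^T\mathbf C^{-1}\mathbf l=0$ has a unique real solution if and only if the line $\mathbf l$ passes through one of the points $\hat{\mathbf x}_1,\hat{\mathbf x}_2,\hat{\mathbf x}_3,\hat{\mathbf x}_4,\boldsymbol\xi_1,\boldsymbol\xi_2,\boldsymbol\xi_3$, where $\boldsymbol\xi_1,\boldsymbol\xi_2,\boldsymbol\xi_3$ are the three vertices of the diagonal triangle of the quadrangle $\hat{\mathbf x}_1\hat{\mathbf x}_2\hat{\mathbf x}_3\hat{\mathbf x}_4$.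
   Context: $\mathrm P\mathbb R^2$ is the real projective plane. A hat denotes a finite point in normalized homogeneous coordinates, i.e. a vector of $\mathbb R^3$ whose third component is $1$. A line is given by a nonzero vector $\mathbf l\in\mathbb R^3$ (up to scale), and $\mathbf x$ lies on $\mathbf l$ iff $\mathbf x^T\mathbf l=0$. The vertices of the diagonal triangle are $\boldsymbol\xi_1=(\hat{\mathbf x}_1\times\hat{\mathbf x}_2)\times(\hat{\mathbf x}_3\times\hat{\mathbf x}_4)$, $\boldsymbol\xi_2=(\hat{\mathbf x}_1\times\hat{\mathbf x}_3)\times(\hat{\mathbf x}_2\times\hat{\mathbf x}_4)$, $\boldsymbol\xi_3=(\hat{\mathbf x}_1\times\hat{\mathbf x}_4)\times(\hat{\mathbf x}_2\times\hat{\mathbf x}_3)$, where $\times$ is the cross product. Four points and one line are in general position if no three of the points are collinear, $\mathbf l$ is not a side or diagonal line of the quadrangle (i.e. not one of the six lines joining two of the four points), and $\mathbf l$ is not a side of the diagonal triangle (i.e. not one of the three lines joining two of $\boldsymbol\xi_1,\boldsymbol\xi_2,\boldsymbol\xi_3$). A conic is a nonzero symmetric $3\times3$ matrix (complex entries allowed) up to nonzero scale; it is non-degenerate if its determinant is nonzero and real if it can be represented by a real matrix. "Unique real solution" means that there is exactly one real non-degenerate conic (up to scale) satisfying the conditions. *)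

theory Defs
  imports "HOL-Analysis.Analysis"
begin

text \<open>
  Points and lines of the real projective plane are represented by vectors of \<open>real^3\<close>, conics by
  nonzero symmetric matrices in \<open>complex^3^3\<close>. Homogeneous representatives are identified by the
  explicit relations \<open>same_line\<close> and \<open>same_conic\<close>. Finite points are given by their normalized
  representative, as expressed by \<open>finite_point\<close>.
\<close>

definition finite_point :: "real^3 \<Rightarrow> bool" where
  "finite_point x \<longleftrightarrow> x $ 3 = 1"

definition lies_on :: "real^3 \<Rightarrow> real^3 \<Rightarrow> bool" where
  "lies_on x l \<longleftrightarrow> x \<bullet> l = 0"

definition same_line :: "real^3 \<Rightarrow> real^3 \<Rightarrow> bool" where
  "same_line l m \<longleftrightarrow> (\<exists>k. k \<noteq> 0 \<and> l = k *\<^sub>R m)"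

text \<open>
  This is collinearity in the projective plane, not the library's affine \<open>collinear\<close> in \<open>real^3\<close>.
  Three points that are not all distinct are always collinear.
\<close>

definition proj_collinear :: "real^3 \<Rightarrow> real^3 \<Rightarrow> real^3 \<Rightarrow> bool" where
  "proj_collinear p q r \<longleftrightarrow> (\<exists>m. m \<noteq> 0 \<and> lies_on p m \<and> lies_on q m \<and> lies_on r m)"

definition diag1 :: "real^3 \<Rightarrow> real^3 \<Rightarrow> real^3 \<Rightarrow> real^3 \<Rightarrow> real^3" where
  "diag1 x1 x2 x3 x4 = cross3 (cross3 x1 x2) (cross3 x3 x4)"

definition diag2 :: "real^3 \<Rightarrow> real^3 \<Rightarrow> real^3 \<Rightarrow> real^3 \<Rightarrow> real^3" where
  "diag2 x1 x2 x3 x4 = cross3 (cross3 x1 x3) (cross3 x2 x4)"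

definition diag3 :: "real^3 \<Rightarrow> real^3 \<Rightarrow> real^3 \<Rightarrow> real^3 \<Rightarrow> real^3" where
  "diag3 x1 x2 x3 x4 = cross3 (cross3 x1 x4) (cross3 x2 x3)"

definition general_position ::
    "real^3 \<Rightarrow> real^3 \<Rightarrow> real^3 \<Rightarrow> real^3 \<Rightarrow> real^3 \<Rightarrow> bool" where
  "general_position x1 x2 x3 x4 l \<longleftrightarrow>
     \<not> proj_collinear x1 x2 x3 \<and> \<not> proj_collinear x1 x2 x4 \<and>
     \<not> proj_collinear x1 x3 x4 \<and> \<not> proj_collinear x2 x3 x4 \<and>
     \<not> same_line l (cross3 x1 x2) \<and> \<not> same_line l (cross3 x1 x3) \<and>
     \<not> same_line l (cross3 x1 x4) \<and> \<not> same_line l (cross3 x2 x3) \<and>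
     \<not> same_line l (cross3 x2 x4) \<and> \<not> same_line l (cross3 x3 x4) \<and>
     \<not> same_line l (cross3 (diag1 x1 x2 x3 x4) (diag2 x1 x2 x3 x4)) \<and>
     \<not> same_line l (cross3 (diag1 x1 x2 x3 x4) (diag3 x1 x2 x3 x4)) \<and>
     \<not> same_line l (cross3 (diag2 x1 x2 x3 x4) (diag3 x1 x2 x3 x4))"

definition is_conic :: "complex^3^3 \<Rightarrow> bool" where
  "is_conic C \<longleftrightarrow> C \<noteq> 0 \<and> transpose C = C"

definition same_conic :: "complex^3^3 \<Rightarrow> complex^3^3 \<Rightarrow> bool" where
  "same_conic C D \<longleftrightarrow> (\<exists>k. k \<noteq> 0 \<and> C = (\<chi> i j. k * D $ i $ j))"

definition complex_vec :: "real^3 \<Rightarrow> complex^3" where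
  "complex_vec v = (\<chi> i. complex_of_real (v $ i))"

definition complex_mat :: "real^3^3 \<Rightarrow> complex^3^3" where
  "complex_mat M = (\<chi> i j. complex_of_real (M $ i $ j))"

definition real_conic :: "complex^3^3 \<Rightarrow> bool" where
  "real_conic C \<longleftrightarrow> (\<exists>M. same_conic C (complex_mat M))"

definition nondegenerate :: "complex^3^3 \<Rightarrow> bool" where
  "nondegenerate C \<longleftrightarrow> det C \<noteq> 0"

text \<open>
  The form \<open>v\<^sup>T M v\<close> is bilinear, without conjugation. The library's inner product on \<open>complex^3\<close>
  is real-valued and cannot be used for it.
\<close>

definition quad_form :: "complex^3^3 \<Rightarrow> complex^3 \<Rightarrow> complex" where
  "quad_form M v = scalar_product v (M *v v)"

definition conic_solution ::
    "real^3 \<Rightarrow> real^3 \<Rightarrow> real^3 \<Rightarrow> real^3 \<Rightarrow> real^3 \<Rightarrow> complex^3^3 \<Rightarrow> bool" where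
  "conic_solution x1 x2 x3 x4 l C \<longleftrightarrow>
     is_conic C \<and> nondegenerate C \<and>
     (\<forall>x\<in>{x1, x2, x3, x4}. quad_form C (complex_vec x) = 0) \<and>
     quad_form (matrix_inv C) (complex_vec l) = 0"

definition unique_real_solution ::
    "real^3 \<Rightarrow> real^3 \<Rightarrow> real^3 \<Rightarrow> real^3 \<Rightarrow> real^3 \<Rightarrow> bool" where
  "unique_real_solution x1 x2 x3 x4 l \<longleftrightarrow>
     (\<exists>C. conic_solution x1 x2 x3 x4 l C \<and> real_conic C \<and>
        (\<forall>D. conic_solution x1 x2 x3 x4 l D \<and> real_conic D \<longrightarrow> same_conic D C))"

end

theory Submission
  imports Defs
begin

text \<open>
  In a suitable projective frame three of the points are the unit vectors and the fourth is
  \<open>(1, 1, 1)\<close>. The conics through them then have a zero diagonal, and off-diagonal entries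
  \<open>h = - (f + g)\<close>, \<open>g\<close>, \<open>f\<close> that add up to zero: they form a pencil with parameter \<open>(f : g)\<close>, whose
  degenerate members, given by \<open>f = 0\<close>, \<open>g = 0\<close> and \<open>f + g = 0\<close>, are the three pairs of opposite
  sides of the quadrangle. Tangency to the line \<open>(p, q, r)\<close> is one quadratic equation in
  \<open>(f : g)\<close>, so there are at most two solutions, and everything is decided by that quadratic.

  Its discriminant is, up to a positive factor, \<open>- p q r (p + q + r)\<close>, minus the product of the
  incidences of the line with the four points: a double root occurs exactly if the line passes through one of them.
  Its value at a degenerate member is the square of \<open>p + q\<close>, \<open>p + r\<close> or \<open>q + r\<close>, the incidence of the
  line with the vertex of the diagonal triangle that is the singular point of this member: one of the
  roots is lost to degeneracy exactly if the line passes through such a vertex. In both cases general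
  position keeps the remaining root non-degenerate. If the line avoids all seven points, the roots are
  distinct and non-degenerate, so there are two real solutions or none. This analysis is \<open>admissible_parameter_unique_iff\<close>.

  The reduction to it has three parts. \<open>unique_real_solution_iff\<close> replaces complex matrices by
  real ones, \<open>real_solution_congruence\<close> moves the problem to the frame provided by
  \<open>quadrangle_frame\<close>, and \<open>real_solution_frame_iff\<close> identifies the solutions there with the roots.
\<close>

section \<open>The quadratic equation of the pencil\<close>

text \<open>
  The first three conditions say that the member of the pencil is non-degenerate, the last one that
  it touches the line \<open>(p, q, r)\<close>.
\<close>

definition admissible_parameter :: "real \<Rightarrow> real \<Rightarrow> real \<Rightarrow> real \<Rightarrow> real \<Rightarrow> bool" where
  "admissible_parameter p q r f g \<longleftrightarrow> f \<noteq> 0 \<and> g \<noteq> 0 \<and> f + g \<noteq> 0 \<and>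
    f\<^sup>2 * (p + r)\<^sup>2 + 2 * f * g * (r\<^sup>2 - p * q + p * r + q * r) + g\<^sup>2 * (q + r)\<^sup>2 = 0"

text \<open>
  Write the quadratic as \<open>a f\<^sup>2 + 2 b f g + c g\<^sup>2\<close>. If it has a degenerate root, a linear factor
  splits off and the other factor gives the only admissible root; general position makes the latter
  non-degenerate. Otherwise every real root is admissible, and completing the square shows that the
  real root is unique exactly if the discriminant vanishes. The nine hypotheses say that the line is
  not one of the six sides of the quadrangle or the three sides of the diagonal triangle, as
  \<open>p + q + r\<close> belongs to the fourth point and \<open>p + q\<close>, \<open>p + r\<close>, \<open>q + r\<close> to the diagonal points.
\<close>

lemma admissible_parameter_unique_iff:
  fixes p q r :: real
  assumes "\<not> (p = 0 \<and> q = 0)" "\<not> (p = 0 \<and> r = 0)" "\<not> (q = 0 \<and> r = 0)"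
    and "\<not> (p = 0 \<and> q + r = 0)" "\<not> (q = 0 \<and> p + r = 0)" "\<not> (r = 0 \<and> p + q = 0)"
    and "\<not> (p + q = 0 \<and> p + r = 0)" "\<not> (p + q = 0 \<and> q + r = 0)" "\<not> (p + r = 0 \<and> q + r = 0)"
  shows "(\<exists>f g. admissible_parameter p q r f g \<and>
            (\<forall>f' g'. admissible_parameter p q r f' g' \<longrightarrow> f * g' = f' * g)) \<longleftrightarrow>
    p = 0 \<or> q = 0 \<or> r = 0 \<or> p + q + r = 0 \<or> p + q = 0 \<or> p + r = 0 \<or> q + r = 0"
proof -
  define a b c where "a = (p + r)\<^sup>2" and "b = r\<^sup>2 - p * q + p * r + q * r" and "c = (q + r)\<^sup>2"
  define \<Delta> where "\<Delta> = - 4 * p * q * r * (p + q + r)"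
  have adm: "admissible_parameter p q r f g \<longleftrightarrow> f \<noteq> 0 \<and> g \<noteq> 0 \<and> f + g \<noteq> 0 \<and>
      a * f\<^sup>2 + 2 * b * f * g + c * g\<^sup>2 = 0" for f g
    by (simp add: admissible_parameter_def a_def b_def c_def mult_ac)
  have disc: "b\<^sup>2 - a * c = \<Delta>"
    unfolding a_def b_def c_def \<Delta>_def by algebra
  (* The value of the quadratic at f = 1, g = -1, the third degenerate member. *)
  have third: "a - 2 * b + c = (p + q)\<^sup>2"
    unfolding a_def b_def c_def by algebra
  consider "p + r = 0" | "q + r = 0" | "p + q = 0" "p + r \<noteq> 0" "q + r \<noteq> 0"
    | "p + q \<noteq> 0" "p + r \<noteq> 0" "q + r \<noteq> 0" by blast
  then show ?thesis
  proof cases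
    case 1
    then have p: "p = - r" by simp
    have a: "a = 0" and b: "b = 2 * q * r"
      using p by (simp_all add: a_def b_def power2_eq_square)
    have nz: "b \<noteq> 0" "c \<noteq> 0" using assms 1 by (auto simp: b c_def p)
    have "c - 2 * b \<noteq> 0" using third a assms 1 by auto
    then have "admissible_parameter p q r c (- 2 * b)"
      using nz by (simp add: adm a power2_eq_square)
    moreover have "c * g' = f' * (- 2 * b)" if "admissible_parameter p q r f' g'" for f' g'
    proof -
      have "g' * (2 * b * f' + c * g') = 0" "g' \<noteq> 0"
        using that by (auto simp: adm a power2_eq_square algebra_simps)
      then have "2 * b * f' + c * g' = 0" by (metis mult_eq_0_iff)
      then show ?thesis by (simp add: algebra_simps)
    qed
    ultimately show ?thesis using 1 by blast
  next
    case 2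
    then have q: "q = - r" by simp
    have c: "c = 0" and b: "b = 2 * p * r"
      using q by (simp_all add: c_def b_def power2_eq_square)
    have nz: "b \<noteq> 0" "a \<noteq> 0" using assms 2 by (auto simp: b a_def q)
    have "a - 2 * b \<noteq> 0" using third c assms 2 by auto
    then have "admissible_parameter p q r (- 2 * b) a"
      using nz by (simp add: adm c power2_eq_square)
    moreover have "(- 2 * b) * g' = f' * a" if "admissible_parameter p q r f' g'" for f' g'
    proof -
      have "f' * (a * f' + 2 * b * g') = 0" "f' \<noteq> 0"
        using that by (auto simp: adm c power2_eq_square algebra_simps)
      then have "a * f' + 2 * b * g' = 0" by (metis mult_eq_0_iff)
      then show ?thesis by (simp add: algebra_simps)
    qed
    ultimately show ?thesis using 2 by blast
  next
    case 3
    then have p: "p = - q" by simp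
    have nz: "a \<noteq> 0" "c \<noteq> 0" using 3 by (auto simp: a_def c_def)
    have b: "2 * b = a + c" using third p by simp
    have "c - a = 4 * q * r" unfolding a_def c_def p by (simp add: power2_eq_square algebra_simps)
    then have "c - a \<noteq> 0" using assms p by auto
    moreover have "a * c\<^sup>2 + 2 * b * c * (- a) + c * (- a)\<^sup>2 = 0"
      unfolding b by algebra
    ultimately have "admissible_parameter p q r c (- a)"
      using nz by (simp add: adm)
    moreover have "c * g' = f' * (- a)" if "admissible_parameter p q r f' g'" for f' g'
    proof -
      have "(f' + g') * (a * f' + c * g') = a * f'\<^sup>2 + 2 * b * f' * g' + c * g'\<^sup>2"
        unfolding b by algebra
      then have "(f' + g') * (a * f' + c * g') = 0" "f' + g' \<noteq> 0"
        using that by (auto simp: adm)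
      then have "a * f' + c * g' = 0" by (metis mult_eq_0_iff)
      then show ?thesis by (simp add: algebra_simps)
    qed
    ultimately show ?thesis using 3 by blast
  next
    case 4
    then have nz: "a \<noteq> 0" "c \<noteq> 0" by (auto simp: a_def c_def)
    have square: "a * (a * f\<^sup>2 + 2 * b * f * g + c * g\<^sup>2) = (a * f + b * g)\<^sup>2 - \<Delta> * g\<^sup>2" for f g
      unfolding disc[symmetric] by algebra
    have root: "admissible_parameter p q r f g \<longleftrightarrow>
        (a * f + b * g)\<^sup>2 = \<Delta> * g\<^sup>2" if "g \<noteq> 0" for f g
    proof -
      have "f \<noteq> 0" if Q: "a * f\<^sup>2 + 2 * b * f * g + c * g\<^sup>2 = 0"
        using Q nz \<open>g \<noteq> 0\<close> by auto
      moreover have "f + g \<noteq> 0" if Q: "a * f\<^sup>2 + 2 * b * f * g + c * g\<^sup>2 = 0"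
      proof
        assume "f + g = 0"
        then have "f = - g" by simp
        then have "(a - 2 * b + c) * g\<^sup>2 = 0" using Q by (simp add: power2_eq_square algebra_simps)
        then show False using third 4 \<open>g \<noteq> 0\<close> by simp
      qed
      ultimately show ?thesis
        using square[of f g] nz that unfolding adm by (metis eq_iff_diff_eq_0 mult_eq_0_iff)
    qed
    have "(\<exists>f g. admissible_parameter p q r f g \<and>
            (\<forall>f' g'. admissible_parameter p q r f' g' \<longrightarrow> f * g' = f' * g)) \<longleftrightarrow> \<Delta> = 0"
    proof
      assume \<Delta>: "\<Delta> = 0"
      have "admissible_parameter p q r (- b) a"
        using root[of a "- b"] nz \<Delta> by (simp add: algebra_simps)
      moreover have "(- b) * g' = f' * a" if "admissible_parameter p q r f' g'" for f' g'
        using that root[of g' f'] \<Delta> by (auto simp: adm algebra_simps)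
      ultimately show "\<exists>f g. admissible_parameter p q r f g \<and>
            (\<forall>f' g'. admissible_parameter p q r f' g' \<longrightarrow> f * g' = f' * g)" by blast
    next
      assume "\<exists>f g. admissible_parameter p q r f g \<and>
            (\<forall>f' g'. admissible_parameter p q r f' g' \<longrightarrow> f * g' = f' * g)"
      then obtain f g where sol: "admissible_parameter p q r f g"
        and uniq: "\<And>f' g'. admissible_parameter p q r f' g' \<Longrightarrow> f * g' = f' * g" by blast
      have g: "g \<noteq> 0" using sol by (simp add: adm)
      (* The conjugate root is obtained by changing the sign of a * f + b * g. *)
      have eq: "(a * f + b * g)\<^sup>2 = \<Delta> * g\<^sup>2" using root[OF g] sol by blast
      have "a * (- f - 2 * b * g / a) + b * g = - (a * f + b * g)"
        using nz by (simp add: field_simps)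
      then have "(a * (- f - 2 * b * g / a) + b * g)\<^sup>2 = \<Delta> * g\<^sup>2"
        using eq by (metis power2_minus)
      then have "admissible_parameter p q r (- f - 2 * b * g / a) g"
        using root[OF g] by blast
      then have "f = - f - 2 * b * g / a" using uniq g by fastforce
      then have "a * f + b * g = 0" using nz by (simp add: field_simps)
      then show "\<Delta> = 0" using eq g by simp
    qed
    then show ?thesis using 4 by (auto simp: \<Delta>_def)
  qed
qed

section \<open>From complex to real matrices\<close>

text \<open>
  The condition \<open>l\<^sup>T M\<^sup>-\<^sup>1 l = 0\<close> is expressed by the pole of \<open>l\<close>, the point \<open>v\<close> with \<open>M v = l\<close>:
  the line touches the conic if it contains its own pole. This form carries no inverse matrix through
  changes of coordinates.
\<close>

definition real_solution :: "(real^'n) set \<Rightarrow> real^'n \<Rightarrow> real^'n^'n \<Rightarrow> bool" where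
  "real_solution X l M \<longleftrightarrow> transpose M = M \<and> invertible M \<and>
     (\<forall>x\<in>X. x \<bullet> (M *v x) = 0) \<and> (\<exists>v. M *v v = l \<and> v \<bullet> l = 0)"

definition unique_up_to_scale :: "(real^'n^'m \<Rightarrow> bool) \<Rightarrow> bool" where
  "unique_up_to_scale S \<longleftrightarrow> (\<exists>M. S M \<and> (\<forall>N. S N \<longrightarrow> (\<exists>k. k \<noteq> 0 \<and> N = k *\<^sub>R M)))"

lemma matrix_inv_unique:
  fixes A B :: "'a::field^'n^'n"
  assumes "A ** B = mat 1"
  shows "matrix_inv A = B"
proof -
  have "\<exists>B. A ** B = mat 1 \<and> B ** A = mat 1"
    using assms matrix_left_right_inverse by blast
  then have "matrix_inv A ** A = mat 1"
    unfolding matrix_inv_def by (metis (mono_tags, lifting) someI_ex)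
  then show ?thesis
    using assms by (metis matrix_mul_assoc matrix_mul_lid matrix_mul_rid)
qed

lemma quad_form_scaled_complex_mat:
  "quad_form (\<chi> i j. k * complex_mat M $ i $ j) (complex_vec x) = k * complex_of_real (x \<bullet> (M *v x))"
  by (simp add: quad_form_def scalar_product_def complex_mat_def complex_vec_def
      matrix_vector_mult_def inner_vec_def sum_distrib_left mult_ac)

text \<open>
  Every real conic is represented by a complex multiple of a real matrix, and all conditions are
  homogeneous, so that they can be read off the real matrix.
\<close>

lemma conic_solution_scaled_complex_mat:
  assumes "k \<noteq> 0"
  shows "conic_solution x1 x2 x3 x4 l (\<chi> i j. k * complex_mat M $ i $ j) \<longleftrightarrow>
    real_solution {x1, x2, x3, x4} l M"
    (is "conic_solution _ _ _ _ _ ?C \<longleftrightarrow> _")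
proof -
  have sym: "transpose ?C = ?C \<longleftrightarrow> transpose M = M"
    using assms by (simp add: transpose_def complex_mat_def vec_eq_iff)
  have "det ?C = k ^ 3 * complex_of_real (det M)"
    by (simp add: det_3 complex_mat_def power3_eq_cube algebra_simps)
  then have det: "nondegenerate ?C \<longleftrightarrow> invertible M"
    using assms by (simp add: nondegenerate_def invertible_det_nz)
  have nz: "?C \<noteq> 0" if "invertible M"
  proof
    assume zero: "?C = 0"
    have "nondegenerate ?C" using det that by blast
    then show False unfolding zero by (simp add: nondegenerate_def det_3)
  qed
  have tangent: "quad_form (matrix_inv ?C) (complex_vec l) = 0 \<longleftrightarrow> (\<exists>v. M *v v = l \<and> v \<bullet> l = 0)"
    if inv: "invertible M"
  proof -
    obtain A :: "real^3^3" where A: "M ** A = mat 1" "A ** M = mat 1"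
      using inv unfolding invertible_def by blast
    have "(\<Sum>j\<in>UNIV. k * complex_mat M $ i $ j * (inverse k * complex_mat A $ j $ i')) =
        complex_of_real ((M ** A) $ i $ i')" for i i'
      using assms by (auto simp: complex_mat_def matrix_matrix_mult_def field_simps intro!: sum.cong)
    then have "?C ** (\<chi> i j. inverse k * complex_mat A $ i $ j) = mat 1"
      unfolding A(1) by (simp add: vec_eq_iff matrix_matrix_mult_def mat_def)
    then have "matrix_inv ?C = (\<chi> i j. inverse k * complex_mat A $ i $ j)"
      by (rule matrix_inv_unique)
    then have "quad_form (matrix_inv ?C) (complex_vec l) = 0 \<longleftrightarrow> l \<bullet> (A *v l) = 0"
      using assms by (simp add: quad_form_scaled_complex_mat)
    also have "M *v v = l \<longleftrightarrow> v = A *v l" for v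
      by (metis A matrix_vector_mul_assoc matrix_vector_mul_lid)
    then have "l \<bullet> (A *v l) = 0 \<longleftrightarrow> (\<exists>v. M *v v = l \<and> v \<bullet> l = 0)"
      by (simp add: inner_commute)
    finally show ?thesis .
  qed
  have points: "quad_form ?C (complex_vec x) = 0 \<longleftrightarrow> x \<bullet> (M *v x) = 0" for x
    using assms by (simp add: quad_form_scaled_complex_mat)
  show ?thesis
    unfolding conic_solution_def real_solution_def is_conic_def
    using sym det nz tangent points by blast
qed

text \<open>
  The factor between two proportional real matrices is real because it is the quotient of two
  corresponding real entries.
\<close>

lemma same_conic_scaled_complex_mat:
  assumes "k \<noteq> 0" "k' \<noteq> 0" "M \<noteq> 0"
  shows "same_conic (\<chi> i j. k' * complex_mat N $ i $ j) (\<chi> i j. k * complex_mat M $ i $ j) \<longleftrightarrow>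
    (\<exists>c. c \<noteq> 0 \<and> N = c *\<^sub>R M)"
proof
  assume "same_conic (\<chi> i j. k' * complex_mat N $ i $ j) (\<chi> i j. k * complex_mat M $ i $ j)"
  then obtain d where d: "d \<noteq> 0"
    and "\<And>i j. k' * complex_of_real (N $ i $ j) = d * (k * complex_of_real (M $ i $ j))"
    by (auto simp: same_conic_def complex_mat_def vec_eq_iff)
  then have eq: "complex_of_real (N $ i $ j) = d * k / k' * complex_of_real (M $ i $ j)" for i j
    using assms by (simp add: field_simps)
  obtain i j where ij: "M $ i $ j \<noteq> 0"
    using assms by (metis vec_eq_iff zero_index)
  define c where "c = N $ i $ j / M $ i $ j"
  have c: "complex_of_real c = d * k / k'"
    using eq[of i j] ij by (simp add: c_def)
  then have "c \<noteq> 0" using d assms by auto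
  moreover have "N $ i $ j = c * M $ i $ j" for i j
    using eq[of i j] unfolding c[symmetric] by (metis of_real_eq_iff of_real_mult)
  ultimately show "\<exists>c. c \<noteq> 0 \<and> N = c *\<^sub>R M" by (auto simp: vec_eq_iff)
next
  assume "\<exists>c. c \<noteq> 0 \<and> N = c *\<^sub>R M"
  then obtain c where "c \<noteq> 0" "N = c *\<^sub>R M" by blast
  then show "same_conic (\<chi> i j. k' * complex_mat N $ i $ j) (\<chi> i j. k * complex_mat M $ i $ j)"
    using assms unfolding same_conic_def
    by (intro exI[of _ "k' * complex_of_real c / k"]) (simp add: complex_mat_def vec_eq_iff)
qed

lemma unique_real_solution_iff:
  "unique_real_solution x1 x2 x3 x4 l \<longleftrightarrow> unique_up_to_scale (real_solution {x1, x2, x3, x4} l)"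
    (is "_ \<longleftrightarrow> unique_up_to_scale ?S")
proof -
  have nz: "M \<noteq> 0" if "?S M" for M
    using that by (auto simp: real_solution_def invertible_det_nz det_3)
  have sol: "conic_solution x1 x2 x3 x4 l C \<and> real_conic C \<longleftrightarrow>
      (\<exists>k M. k \<noteq> 0 \<and> C = (\<chi> i j. k * complex_mat M $ i $ j) \<and> ?S M)" for C
    unfolding real_conic_def same_conic_def using conic_solution_scaled_complex_mat by blast
  have lift: "conic_solution x1 x2 x3 x4 l (\<chi> i j. 1 * complex_mat M $ i $ j) \<and>
      real_conic (\<chi> i j. 1 * complex_mat M $ i $ j)" if M: "?S M" for M
    unfolding sol by (rule exI[of _ 1], rule exI[of _ M]) (use M in simp)
  show ?thesis
  proof
    assume "unique_real_solution x1 x2 x3 x4 l"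
    then obtain C where C: "conic_solution x1 x2 x3 x4 l C \<and> real_conic C"
      and uniq: "\<And>D. conic_solution x1 x2 x3 x4 l D \<and> real_conic D \<Longrightarrow> same_conic D C"
      unfolding unique_real_solution_def by blast
    obtain k M where kM: "k \<noteq> 0" "C = (\<chi> i j. k * complex_mat M $ i $ j)" "?S M"
      using C sol by blast
    have "\<exists>c. c \<noteq> 0 \<and> N = c *\<^sub>R M" if "?S N" for N
    proof -
      have "same_conic (\<chi> i j. 1 * complex_mat N $ i $ j) C"
        by (rule uniq[OF lift[OF that]])
      then show ?thesis
        unfolding kM(2) using same_conic_scaled_complex_mat[of k 1 M N] kM(1) nz[OF kM(3)]
        by (simp only: one_neq_zero not_False_eq_True simp_thms)
    qed
    then show "unique_up_to_scale ?S" using kM(3) unfolding unique_up_to_scale_def by blast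
  next
    assume "unique_up_to_scale ?S"
    then obtain M where M: "?S M" and uniq: "\<And>N. ?S N \<Longrightarrow> \<exists>c. c \<noteq> 0 \<and> N = c *\<^sub>R M"
      unfolding unique_up_to_scale_def by blast
    have one: "(1::complex) \<noteq> 0" by simp
    have "same_conic D (\<chi> i j. 1 * complex_mat M $ i $ j)"
      if D: "conic_solution x1 x2 x3 x4 l D \<and> real_conic D" for D
    proof -
      obtain k N where N: "k \<noteq> 0" "D = (\<chi> i j. k * complex_mat N $ i $ j)" "?S N"
        using D sol by blast
      show ?thesis
        unfolding N(2) same_conic_scaled_complex_mat[OF one N(1) nz[OF M]]
        by (rule uniq[OF N(3)])
    qed
    with lift[OF M] show "unique_real_solution x1 x2 x3 x4 l"
      unfolding unique_real_solution_def by blast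
  qed
qed

section \<open>Change of projective coordinates\<close>

lemma inner_congruence:
  fixes M P :: "real^'n^'n"
  shows "u \<bullet> ((transpose P ** M ** P) *v v) = (P *v u) \<bullet> (M *v (P *v v))"
  by (metis dot_lmul_matrix matrix_vector_mul_assoc vector_transpose_matrix)

text \<open>
  Points are moved by \<open>P\<close>, while lines and conics are pulled back along it, by the transpose and by
  congruence. The poles of the two lines correspond to each other as points, so tangency is preserved.
\<close>

lemma real_solution_congruence:
  fixes P :: "real^'n^'n"
  assumes P: "invertible P"
  shows "real_solution ((*v) P ` X) l M \<longleftrightarrow>
    real_solution X (transpose P *v l) (transpose P ** M ** P)"
proof -
  obtain Q where Q: "P ** Q = mat 1" "Q ** P = mat 1"
    using P unfolding invertible_def by blast
  have T: "transpose Q ** transpose P = mat 1"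
    using Q by (metis matrix_transpose_mul transpose_mat)
  have cancel: "transpose Q ** (transpose P ** A ** P) ** Q = A" for A :: "real^'n^'n"
    by (metis Q(1) T matrix_mul_assoc matrix_mul_lid matrix_mul_rid)
  have "transpose (transpose P ** M ** P) = transpose P ** transpose M ** P"
    by (simp add: matrix_transpose_mul matrix_mul_assoc)
  then have "transpose (transpose P ** M ** P) = transpose P ** M ** P \<longleftrightarrow> transpose M = M"
    using cancel by metis
  moreover have "invertible (transpose P ** M ** P) \<longleftrightarrow> invertible M"
    using P by (simp add: invertible_det_nz det_mul det_transpose)
  moreover have "(\<exists>v. (transpose P ** M ** P) *v v = transpose P *v l \<and> v \<bullet> (transpose P *v l) = 0)
    \<longleftrightarrow> (\<exists>v. M *v v = l \<and> v \<bullet> l = 0)"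
  proof -
    have eq: "(transpose P ** M ** P) *v v = transpose P *v l \<longleftrightarrow> M *v (P *v v) = l" for v
      by (metis T matrix_mul_assoc matrix_vector_mul_assoc matrix_vector_mul_lid)
    have "v \<bullet> (transpose P *v l) = (P *v v) \<bullet> l" for v
      by (metis dot_lmul_matrix vector_transpose_matrix transpose_transpose)
    moreover have "v = P *v (Q *v v)" for v
      by (metis Q(1) matrix_vector_mul_assoc matrix_vector_mul_lid)
    ultimately show ?thesis using eq by metis
  qed
  ultimately show ?thesis
    unfolding real_solution_def by (auto simp: inner_congruence)
qed

text \<open>Congruence with an invertible matrix is a linear bijection on matrices.\<close>

lemma unique_up_to_scale_congruence:
  fixes P :: "real^'n^'n"
  assumes "invertible P"
  shows "unique_up_to_scale (\<lambda>M. S (transpose P ** M ** P)) \<longleftrightarrow> unique_up_to_scale S"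
proof -
  obtain Q where Q: "P ** Q = mat 1" "Q ** P = mat 1"
    using assms unfolding invertible_def by blast
  define F where "F M = transpose P ** M ** P" for M
  define G where "G M = transpose Q ** M ** Q" for M
  have T: "transpose Q ** transpose P = mat 1" "transpose P ** transpose Q = mat 1"
    using Q by (metis matrix_transpose_mul transpose_mat)+
  have FG: "F (G M) = M" for M
    unfolding F_def G_def by (metis Q(2) T(2) matrix_mul_assoc matrix_mul_lid matrix_mul_rid)
  have GF: "G (F M) = M" for M
    unfolding F_def G_def by (metis Q(1) T(1) matrix_mul_assoc matrix_mul_lid matrix_mul_rid)
  have lin: "F (k *\<^sub>R M) = k *\<^sub>R F M" "G (k *\<^sub>R M) = k *\<^sub>R G M" for k M
    by (simp_all add: F_def G_def matrix_scalar_ac scalar_matrix_assoc)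
  show ?thesis
    unfolding unique_up_to_scale_def F_def[symmetric] by (metis FG GF lin)
qed

lemma real_solution_scale_points:
  assumes "a \<noteq> 0" "b \<noteq> 0" "c \<noteq> 0" "d \<noteq> 0"
  shows "real_solution {a *\<^sub>R x1, b *\<^sub>R x2, c *\<^sub>R x3, d *\<^sub>R x4} l M \<longleftrightarrow>
    real_solution {x1, x2, x3, x4} l M"
proof -
  have "(e *\<^sub>R x) \<bullet> (M *v (e *\<^sub>R x)) = 0 \<longleftrightarrow> x \<bullet> (M *v x) = 0" if "e \<noteq> 0" for e x
    using that by (simp add: matrix_vector_mult_scaleR del: real_scaleR_def)
  then show ?thesis
    using assms by (simp only: real_solution_def ball_simps simp_thms)
qed

section \<open>The pencil of conics through the frame points\<close>

definition pencil_matrix :: "real \<Rightarrow> real \<Rightarrow> real^3^3" where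
  "pencil_matrix f g = vector [vector [0, - (f + g), g], vector [- (f + g), 0, f], vector [g, f, 0]]"

lemma det_pencil_matrix: "det (pencil_matrix f g) = - 2 * f * g * (f + g)"
  by (simp add: pencil_matrix_def det_3 algebra_simps)

text \<open>
  Passing through the unit vectors kills the diagonal, and passing through \<open>(1, 1, 1)\<close> makes the
  sum of all entries zero. For tangency, let \<open>v\<close> be the pole of \<open>m\<close>: the incidence
  \<open>v \<bullet> m\<close> times the negative determinant is the quadratic form in \<open>(f, g)\<close>.
\<close>

lemma real_solution_frame_iff:
  "real_solution {axis 1 1, axis 2 1, axis 3 1, vector [1, 1, 1]} m N \<longleftrightarrow>
    (\<exists>f g. N = pencil_matrix f g \<and> admissible_parameter (m $ 1) (m $ 2) (m $ 3) f g)"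
proof -
  have diagonal: "axis i 1 \<bullet> (N *v axis i 1) = N $ i $ i" for i
    by (simp add: inner_axis' matrix_vector_mult_basis column_def)
  have total: "vector [1, 1, 1] \<bullet> (N *v vector [1, 1, 1]) =
      N $ 1 $ 1 + N $ 1 $ 2 + N $ 1 $ 3 + (N $ 2 $ 1 + N $ 2 $ 2 + N $ 2 $ 3)
      + (N $ 3 $ 1 + N $ 3 $ 2 + N $ 3 $ 3)"
    by (simp add: inner_vec_def matrix_vector_mult_def sum_3)
  have "transpose N = N \<longleftrightarrow> N $ 1 $ 2 = N $ 2 $ 1 \<and> N $ 1 $ 3 = N $ 3 $ 1 \<and> N $ 2 $ 3 = N $ 3 $ 2"
    by (auto simp only: vec_eq_iff forall_3 transpose_def vec_lambda_beta)
  then have "transpose N = N \<and>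
      (\<forall>x\<in>{axis 1 1, axis 2 1, axis 3 1, vector [1, 1, 1]}. x \<bullet> (N *v x) = 0) \<longleftrightarrow>
      N = pencil_matrix (N $ 3 $ 2) (N $ 3 $ 1)"
    by (simp only: ball_simps diagonal total) (auto simp: pencil_matrix_def vec_eq_iff forall_3)
  also have "\<dots> \<longleftrightarrow> (\<exists>f g. N = pencil_matrix f g)"
    by (auto simp: pencil_matrix_def)
  finally have "transpose N = N \<and>
      (\<forall>x\<in>{axis 1 1, axis 2 1, axis 3 1, vector [1, 1, 1]}. x \<bullet> (N *v x) = 0) \<longleftrightarrow>
      (\<exists>f g. N = pencil_matrix f g)" .
  moreover have "invertible (pencil_matrix f g) \<and> (\<exists>v. pencil_matrix f g *v v = m \<and> v \<bullet> m = 0) \<longleftrightarrow>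
      admissible_parameter (m $ 1) (m $ 2) (m $ 3) f g" for f g
  proof -
    let ?N = "pencil_matrix f g"
    let ?Q = "f\<^sup>2 * (m $ 1 + m $ 3)\<^sup>2
      + 2 * f * g * ((m $ 3)\<^sup>2 - m $ 1 * m $ 2 + m $ 1 * m $ 3 + m $ 2 * m $ 3)
      + g\<^sup>2 * (m $ 2 + m $ 3)\<^sup>2"
    have inv: "invertible ?N \<longleftrightarrow> f \<noteq> 0 \<and> g \<noteq> 0 \<and> f + g \<noteq> 0"
      by (simp add: invertible_det_nz det_pencil_matrix)
    have pole: "- det ?N * (v \<bullet> m) = ?Q" if v: "?N *v v = m" for v
    proof -
      have m: "m $ 1 = - (f + g) * v $ 2 + g * v $ 3" "m $ 2 = - (f + g) * v $ 1 + f * v $ 3"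
        "m $ 3 = g * v $ 1 + f * v $ 2"
        unfolding v[symmetric] by (simp_all add: pencil_matrix_def matrix_vector_mult_def sum_3)
      show ?thesis
        unfolding det_pencil_matrix inner_vec_def sum_3 inner_real_def m by algebra
    qed
    have "\<exists>v. ?N *v v = m" if "invertible ?N"
      using that unfolding invertible_def
      by (metis matrix_vector_mul_assoc matrix_vector_mul_lid)
    moreover have "v \<bullet> m = 0 \<longleftrightarrow> ?Q = 0" if "invertible ?N" "?N *v v = m" for v
      using pole[OF that(2)] that(1) by (auto simp: invertible_det_nz)
    moreover have "admissible_parameter (m $ 1) (m $ 2) (m $ 3) f g \<longleftrightarrow> invertible ?N \<and> ?Q = 0"
      by (simp only: admissible_parameter_def inv conj_assoc)
    ultimately show ?thesis by blast
  qed
  ultimately show ?thesis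
    unfolding real_solution_def by blast
qed

lemma unique_up_to_scale_frame_iff:
  fixes m :: "real^3"
  shows "unique_up_to_scale (real_solution {axis 1 1, axis 2 1, axis 3 1, vector [1, 1, 1]} m) \<longleftrightarrow>
    (\<exists>f g. admissible_parameter (m $ 1) (m $ 2) (m $ 3) f g \<and>
      (\<forall>f' g'. admissible_parameter (m $ 1) (m $ 2) (m $ 3) f' g' \<longrightarrow> f * g' = f' * g))"
proof -
  let ?A = "admissible_parameter (m $ 1) (m $ 2) (m $ 3)"
  have proportional: "(\<exists>k. k \<noteq> 0 \<and> pencil_matrix f' g' = k *\<^sub>R pencil_matrix f g) \<longleftrightarrow> f * g' = f' * g"
    if "?A f g" "?A f' g'" for f g f' g'
  proof
    assume "\<exists>k. k \<noteq> 0 \<and> pencil_matrix f' g' = k *\<^sub>R pencil_matrix f g"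
    then show "f * g' = f' * g"
      by (auto simp: pencil_matrix_def vec_eq_iff forall_3)
  next
    assume "f * g' = f' * g"
    moreover have "f \<noteq> 0" "f' \<noteq> 0" using that by (auto simp: admissible_parameter_def)
    ultimately show "\<exists>k. k \<noteq> 0 \<and> pencil_matrix f' g' = k *\<^sub>R pencil_matrix f g"
      by (intro exI[of _ "f' / f"]) (auto simp: pencil_matrix_def vec_eq_iff forall_3 field_simps)
  qed
  have "(\<exists>M. (\<exists>f g. M = pencil_matrix f g \<and> ?A f g) \<and> R M) \<longleftrightarrow> (\<exists>f g. ?A f g \<and> R (pencil_matrix f g))"
    for R by blast
  moreover have "(\<forall>M. (\<exists>f g. M = pencil_matrix f g \<and> ?A f g) \<longrightarrow> R M) \<longleftrightarrow>
      (\<forall>f g. ?A f g \<longrightarrow> R (pencil_matrix f g))" for R by blast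
  ultimately show ?thesis
    unfolding unique_up_to_scale_def real_solution_frame_iff using proportional by (simp cong: conj_cong)
qed

section \<open>The frame of a quadrangle\<close>

lemma proj_collinear_iff_det: "proj_collinear x y z \<longleftrightarrow> x \<bullet> cross3 y z = 0"
proof -
  let ?A = "vector [x, y, z] :: real^3^3"
  have "?A *v m = 0 \<longleftrightarrow> lies_on x m \<and> lies_on y m \<and> lies_on z m" for m
    by (simp add: lies_on_def vec_eq_iff forall_3 matrix_vector_mult_def inner_vec_def)
  then have "proj_collinear x y z \<longleftrightarrow> (\<exists>m. m \<noteq> 0 \<and> ?A *v m = 0)"
    unfolding proj_collinear_def by blast
  also have "\<dots> \<longleftrightarrow> \<not> invertible ?A"
    unfolding invertible_left_inverse matrix_left_invertible_ker by blast
  finally show ?thesis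
    by (simp add: invertible_det_nz dot_cross_det)
qed

text \<open>
  By the Lagrange identity a vector orthogonal to both \<open>u\<close> and \<open>v\<close> is parallel to their cross
  product.
\<close>

lemma same_line_cross:
  assumes "l \<noteq> 0" "cross3 u v \<noteq> 0" "u \<bullet> l = 0" "v \<bullet> l = 0"
  shows "same_line l (cross3 u v)"
proof -
  have "cross3 l (cross3 u v) = 0"
    using assms(3,4) Lagrange[of l u v] by (simp add: inner_commute)
  then have "(cross3 u v \<bullet> cross3 u v) *\<^sub>R l = (cross3 u v \<bullet> l) *\<^sub>R cross3 u v"
    using Lagrange[of "cross3 u v" l "cross3 u v"] by simp
  then have "inverse (cross3 u v \<bullet> cross3 u v) *\<^sub>R (cross3 u v \<bullet> cross3 u v) *\<^sub>R l =
      (inverse (cross3 u v \<bullet> cross3 u v) * (cross3 u v \<bullet> l)) *\<^sub>R cross3 u v"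
    by simp
  then have "l = (inverse (cross3 u v \<bullet> cross3 u v) * (cross3 u v \<bullet> l)) *\<^sub>R cross3 u v"
    using assms(2) by simp
  then show ?thesis
    unfolding same_line_def using assms(1) by (metis scaleR_zero_left)
qed

text \<open>
  Coordinates with respect to the basis \<open>x1\<close>, \<open>x2\<close>, \<open>x3\<close>. By Cramer's rule, a vanishing coordinate
  would make \<open>x4\<close> collinear with two of these points.
\<close>

lemma quadrangle_frame:
  assumes "\<not> proj_collinear x1 x2 x3" "\<not> proj_collinear x1 x2 x4"
    and "\<not> proj_collinear x1 x3 x4" "\<not> proj_collinear x2 x3 x4"
  obtains a b c where "a \<noteq> 0" "b \<noteq> 0" "c \<noteq> 0" "x4 = a *\<^sub>R x1 + b *\<^sub>R x2 + c *\<^sub>R x3"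
proof -
  let ?A = "transpose (vector [x1, x2, x3]) :: real^3^3"
  have "invertible ?A"
    using assms(1) by (simp add: invertible_det_nz proj_collinear_iff_det dot_cross_det)
  then obtain w where "?A *v w = x4"
    unfolding invertible_def by (metis matrix_vector_mul_assoc matrix_vector_mul_lid)
  then have x4: "x4 = w $ 1 *\<^sub>R x1 + w $ 2 *\<^sub>R x2 + w $ 3 *\<^sub>R x3"
    by (auto simp: vec_eq_iff forall_3 matrix_vector_mult_def transpose_def sum_3 mult_ac)
  have "x2 \<bullet> cross3 x3 x4 = w $ 1 * (x1 \<bullet> cross3 x2 x3)"
    "x1 \<bullet> cross3 x3 x4 = - w $ 2 * (x1 \<bullet> cross3 x2 x3)"
    "x1 \<bullet> cross3 x2 x4 = w $ 3 * (x1 \<bullet> cross3 x2 x3)"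
    unfolding x4 by (simp_all add: cross3_simps)
  then have "w $ 1 \<noteq> 0" "w $ 2 \<noteq> 0" "w $ 3 \<noteq> 0"
    using assms by (auto simp: proj_collinear_iff_det)
  then show thesis using x4 that by blast
qed

text \<open>
  In the rescaled basis \<open>a x1\<close>, \<open>b x2\<close>, \<open>c x3\<close> the diagonal points have the coordinates
  \<open>(1, 1, 0)\<close>, \<open>(1, 0, 1)\<close> and \<open>(0, 1, 1)\<close> up to the factor \<open>\<plusminus> d\<close>.
\<close>

lemma diag_frame:
  fixes x1 x2 x3 :: "real^3"
  defines "d \<equiv> x1 \<bullet> cross3 x2 x3"
  assumes x4: "x4 = a *\<^sub>R x1 + b *\<^sub>R x2 + c *\<^sub>R x3"
  shows "diag1 x1 x2 x3 x4 = - d *\<^sub>R (a *\<^sub>R x1 + b *\<^sub>R x2)"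
    and "diag2 x1 x2 x3 x4 = d *\<^sub>R (a *\<^sub>R x1 + c *\<^sub>R x3)"
    and "diag3 x1 x2 x3 x4 = d *\<^sub>R (b *\<^sub>R x2 + c *\<^sub>R x3)"
proof -
  have "x1 \<bullet> cross3 x2 x4 = c * d" "x1 \<bullet> cross3 x3 x4 = - b * d" "x1 \<bullet> cross3 x3 x2 = - d"
    "x1 \<bullet> cross3 x4 x3 = b * d" "x1 \<bullet> cross3 x4 x2 = - c * d"
    unfolding x4 d_def by (simp_all add: cross3_simps)
  note dets = this d_def[symmetric]
  show "diag1 x1 x2 x3 x4 = - d *\<^sub>R (a *\<^sub>R x1 + b *\<^sub>R x2)"
    unfolding diag1_def cross_cross_det dot_cross_det[symmetric] dets
    by (simp add: x4 algebra_simps)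
  show "diag2 x1 x2 x3 x4 = d *\<^sub>R (a *\<^sub>R x1 + c *\<^sub>R x3)"
    unfolding diag2_def cross_cross_det dot_cross_det[symmetric] dets
    by (simp add: x4 algebra_simps)
  show "diag3 x1 x2 x3 x4 = d *\<^sub>R (b *\<^sub>R x2 + c *\<^sub>R x3)"
    unfolding diag3_def cross_cross_det dot_cross_det[symmetric] dets
    by (simp add: algebra_simps)
qed

text \<open>
  The vector \<open>w\<close> only witnesses that \<open>u\<close> and \<open>v\<close> are different points, so that their cross product
  represents a line.
\<close>

lemma not_both_incident:
  assumes "\<not> same_line l (cross3 u v)" "l \<noteq> 0" "w \<bullet> cross3 u v \<noteq> 0"
  shows "\<not> (u \<bullet> l = 0 \<and> v \<bullet> l = 0)"
  using assms same_line_cross[of l u v] by (metis inner_zero_right)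

theorem proposition1:
  fixes x1 x2 x3 x4 l :: "real^3"
  assumes "finite_point x1" "finite_point x2" "finite_point x3" "finite_point x4"
    and "l \<noteq> 0"
    and "general_position x1 x2 x3 x4 l"
  shows "unique_real_solution x1 x2 x3 x4 l \<longleftrightarrow>
    (\<exists>p\<in>{x1, x2, x3, x4, diag1 x1 x2 x3 x4, diag2 x1 x2 x3 x4, diag3 x1 x2 x3 x4}. lies_on p l)"
proof -
  note gp = assms(6)[unfolded general_position_def]
  obtain a b c where nz: "a \<noteq> 0" "b \<noteq> 0" "c \<noteq> 0" and x4: "x4 = a *\<^sub>R x1 + b *\<^sub>R x2 + c *\<^sub>R x3"
    using quadrangle_frame gp by blast
  define d where "d = x1 \<bullet> cross3 x2 x3"
  have d: "d \<noteq> 0" using gp by (simp add: d_def proj_collinear_iff_det)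
  note diag = diag_frame[OF x4, folded d_def]
  (* The coordinates of the line in the frame a x1, b x2, c x3 with unit point x4. *)
  define p q r where "p = a * (x1 \<bullet> l)" and "q = b * (x2 \<bullet> l)" and "r = c * (x3 \<bullet> l)"
  have on: "x1 \<bullet> l = 0 \<longleftrightarrow> p = 0" "x2 \<bullet> l = 0 \<longleftrightarrow> q = 0" "x3 \<bullet> l = 0 \<longleftrightarrow> r = 0"
    "x4 \<bullet> l = 0 \<longleftrightarrow> p + q + r = 0"
    "diag1 x1 x2 x3 x4 \<bullet> l = 0 \<longleftrightarrow> p + q = 0"
    "diag2 x1 x2 x3 x4 \<bullet> l = 0 \<longleftrightarrow> p + r = 0"
    "diag3 x1 x2 x3 x4 \<bullet> l = 0 \<longleftrightarrow> q + r = 0"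
    unfolding diag using nz d by (simp_all add: p_def q_def r_def x4 inner_add_left)

  (* The nine lines excluded by general position are honest lines: each is nonzero, as its product
     with some x_i is a nonzero multiple of a power of d. *)
  have side: "x3 \<bullet> cross3 x1 x2 = d" "x2 \<bullet> cross3 x1 x3 = - d" "x1 \<bullet> cross3 x2 x3 = d"
    "x2 \<bullet> cross3 x1 x4 = - c * d" "x1 \<bullet> cross3 x2 x4 = c * d" "x1 \<bullet> cross3 x3 x4 = - b * d"
    unfolding x4 d_def by (simp_all add: cross3_simps)
  have diagonal_side:
    "x1 \<bullet> cross3 (diag1 x1 x2 x3 x4) (diag2 x1 x2 x3 x4) = - b * c * d ^ 3"
    "x2 \<bullet> cross3 (diag1 x1 x2 x3 x4) (diag3 x1 x2 x3 x4) = a * c * d ^ 3"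
    "x3 \<bullet> cross3 (diag2 x1 x2 x3 x4) (diag3 x1 x2 x3 x4) = a * b * d ^ 3"
    unfolding diag
    by (simp_all add: cross_mult_left cross_mult_right cross_add_left cross_add_right
        Cross3.left_diff_distrib Cross3.right_diff_distrib inner_diff_right inner_add_right
        dot_cross_self side power3_eq_cube algebra_simps)
  have triples: "x3 \<bullet> cross3 x1 x2 \<noteq> 0" "x2 \<bullet> cross3 x1 x3 \<noteq> 0" "x1 \<bullet> cross3 x2 x3 \<noteq> 0"
    "x2 \<bullet> cross3 x1 x4 \<noteq> 0" "x1 \<bullet> cross3 x2 x4 \<noteq> 0" "x1 \<bullet> cross3 x3 x4 \<noteq> 0"
    "x1 \<bullet> cross3 (diag1 x1 x2 x3 x4) (diag2 x1 x2 x3 x4) \<noteq> 0"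
    "x2 \<bullet> cross3 (diag1 x1 x2 x3 x4) (diag3 x1 x2 x3 x4) \<noteq> 0"
    "x3 \<bullet> cross3 (diag2 x1 x2 x3 x4) (diag3 x1 x2 x3 x4) \<noteq> 0"
    using nz d by (simp_all only: side diagonal_side) simp_all
  have not_side:
    "\<not> (p = 0 \<and> q = 0)" "\<not> (p = 0 \<and> r = 0)" "\<not> (q = 0 \<and> r = 0)"
    "\<not> (p = 0 \<and> p + q + r = 0)" "\<not> (q = 0 \<and> p + q + r = 0)" "\<not> (r = 0 \<and> p + q + r = 0)"
    "\<not> (p + q = 0 \<and> p + r = 0)" "\<not> (p + q = 0 \<and> q + r = 0)" "\<not> (p + r = 0 \<and> q + r = 0)"
    unfolding on[symmetric] using gp assms(5) triples not_both_incident by blast+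

  (* The columns of ?P are the frame vectors, so ?P sends (1, 1, 1) to x4. *)
  let ?frame = "{axis 1 1, axis 2 1, axis 3 1, vector [1, 1, 1]} :: (real^3) set"
  let ?P = "transpose (vector [a *\<^sub>R x1, b *\<^sub>R x2, c *\<^sub>R x3]) :: real^3^3"
  have "det ?P = a * b * c * d"
    by (simp add: dot_cross_det[symmetric] cross_mult_left cross_mult_right d_def)
  then have P: "invertible ?P" using nz d by (simp add: invertible_det_nz)
  have "(*v) ?P ` ?frame = {a *\<^sub>R x1, b *\<^sub>R x2, c *\<^sub>R x3, 1 *\<^sub>R x4}"
  proof -
    have "?P *v axis 1 1 = a *\<^sub>R x1" "?P *v axis 2 1 = b *\<^sub>R x2" "?P *v axis 3 1 = c *\<^sub>R x3"
      "?P *v vector [1, 1, 1] = 1 *\<^sub>R x4"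
      by (simp_all add: x4 vec_eq_iff forall_3 matrix_vector_mult_def transpose_def sum_3 axis_def)
    then show ?thesis by simp
  qed
  then have "real_solution {x1, x2, x3, x4} l = real_solution ((*v) ?P ` ?frame) l"
    using real_solution_scale_points[OF nz, of 1 x1 x2 x3 x4 l] by auto
  also have "\<dots> = (\<lambda>M. real_solution ?frame (transpose ?P *v l) (transpose ?P ** M ** ?P))"
    using real_solution_congruence[OF P] by blast
  also have "transpose ?P *v l = vector [p, q, r]"
    by (simp add: vec_eq_iff forall_3 matrix_vector_mult_def p_def q_def r_def inner_vec_def
        sum_distrib_left mult_ac)
  finally have "unique_real_solution x1 x2 x3 x4 l \<longleftrightarrow>
      unique_up_to_scale (real_solution ?frame (vector [p, q, r]))"
    by (simp only: unique_real_solution_iff unique_up_to_scale_congruence[OF P])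
  also have "\<dots> \<longleftrightarrow> p = 0 \<or> q = 0 \<or> r = 0 \<or> p + q + r = 0 \<or> p + q = 0 \<or> p + r = 0 \<or> q + r = 0"
    unfolding unique_up_to_scale_frame_iff vector_3
    by (rule admissible_parameter_unique_iff) (use not_side in auto)
  finally show ?thesis by (simp add: lies_on_def on)
qed

end
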